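(* For every even height $h\ge2$, the extended single bifurcation network $\hat\Sigma$ of height $h$, i.e. the structured system $(\hat A,\hat B,\hat C)$ defined in the context, is structurally output controllable.
   Context: **Structural output controllability.** A structured linear system $\dot{\hat x}=\hat A\hat x+\hat Bu$, $\hat y=\hat C\hat x$ with state dimension $\hat n$, whose matrix entries are either fixed or free (generic, independent, arbitrary real) parameters, is structurally output controllable if for some choice of the free parameters the matrix $\hat C[\hat B\ \hat A\hat B\ \cdots\ \hat A^{\hat n-1}\hat B]$ has full row rank. **Single bifurcation network of height $h$ ($h$ even).** The original network has $n=2h+1$ first-order subsystems. The root is $1$, driven by a single scalar input $u$. The left branch is $1\to2\to3\to\cdots\to h+1$ and the right branch is $1\to h+2\to h+3\to\cdots\to 2h+1$. **Extended single bifurcation network.** The subsystems $h+2,h+4,\dots,2h$ of the right branch are replaced with second-order heterogeneous subsystems; all others remain first-order with zero internal dynamics. The state dimension is $\hat n=(h+1)+3h/2$. States are ordered as follows: first those of subsystems $1,\dots,h+1$, then those of the right branch in order, two states for each second-order subsystem followed by the one state of the next first-order subsystem. Below, $\star$ denotes a free parameter (distinct occurrences are independent). The state matrix is $$\hat A=\begin{bmatrix}A^{(11)}&0\\ A^{(21)}&A^{(22)}\end{bmatrix}.$$ Here $A^{(11)}\in\mathbb{R}^{(h+1)\times(h+1)}$ is the transpose of a nilpotent Jordan block with its nonzero entries replaced by free parameters (i.e. free entries on the first subdiagonal, zeros elsewhere). The matrix $A^{(21)}\in\mathbb{R}^{(3h/2)\times(h+1)}$ has a single free entry in position $(2,1)$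 and zeros elsewhere. The matrix $A^{(22)}\in\mathbb{R}^{(3h/2)\times(3h/2)}$ is partitioned into $3\times3$ blocks $A^{(22)}_{ij}$, $i,j\in\{1,\dots,h/2\}$, with $$A^{(22)}_{ij}=\begin{cases}\begin{bmatrix}\star&\star&0\\ \star&\star&0\\ 0&\star&0\end{bmatrix}& i=j,\\[4mm] \begin{bmatrix}0&0&0\\0&0&\star\\0&0&0\end{bmatrix}& i=j+1,\\[4mm] 0&\text{otherwise.}\end{cases}$$ The input matrix $\hat B\in\mathbb{R}^{\hat n\times1}$ has a free entry $\hat b_1$ in its first position and zeros elsewhere. The output matrix is $\hat C=\mathrm{diag}(\hat c_1,\dots,\hat c_n)\in\mathbb{R}^{n\times\hat n}$, with $\hat c_i\in\mathbb{R}^{1\times2}$ having free entries for $i\in\{h+2,h+4,\dots,2h\}$ and $\hat c_i=1$ otherwise. *)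

theory Defs
  imports "Jordan_Normal_Form.DL_Rank"
begin

section \<open>Structured linear systems\<close>

datatype entry = Fixed real | Free

text \<open>The zero and one of \<^typ>\<open>entry\<close> are the corresponding fixed values, so that the
  matrix operations needing only these constants apply to structured matrices.\<close>

instantiation entry :: "{zero, one}"
begin
definition zero_entry :: entry where "zero_entry = Fixed 0"
definition one_entry :: entry where "one_entry = Fixed 1"
instance ..
end

text \<open>Distinct positions carrying \<^const>\<open>Free\<close> are independent parameters, which may take
  any real value (zero included).\<close>

definition realization :: "entry mat \<Rightarrow> real mat \<Rightarrow> bool" where
  "realization S M \<longleftrightarrow> M \<in> carrier_mat (dim_row S) (dim_col S) \<and>
     (\<forall>i < dim_row S. \<forall>j < dim_col S. \<forall>c. S $$ (i, j) = Fixed c \<longrightarrow> M $$ (i, j) = c)"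

text \<open>The horizontal concatenation of the blocks \<open>B, A B, \<dots>, A\<^sup>n\<^sup>-\<^sup>1 B\<close>, where \<open>n\<close> is the state
  dimension: column \<open>q\<close> is column \<open>q mod m\<close> of block \<open>q div m\<close>, where \<open>m\<close> is the number of
  inputs.\<close>

definition controllability_mat :: "real mat \<Rightarrow> real mat \<Rightarrow> real mat" where
  "controllability_mat A B = mat (dim_row A) (dim_row A * dim_col B)
     (\<lambda>(i, q). (A ^\<^sub>m (q div dim_col B) * B) $$ (i, q mod dim_col B))"

definition output_controllable :: "real mat \<Rightarrow> real mat \<Rightarrow> real mat \<Rightarrow> bool" where
  "output_controllable A B C \<longleftrightarrow>
     vec_space.rank (dim_row C) (C * controllability_mat A B) = dim_row C"

definition structurally_output_controllable ::
    "entry mat \<Rightarrow> entry mat \<Rightarrow> entry mat \<Rightarrow> bool" where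
  "structurally_output_controllable SA SB SC \<longleftrightarrow>
     dim_col SA = dim_row SA \<and> dim_row SB = dim_row SA \<and> dim_col SC = dim_row SA \<and>
     (\<exists>A B C. realization SA A \<and> realization SB B \<and> realization SC C \<and>
        output_controllable A B C)"

section \<open>The extended single bifurcation network\<close>

text \<open>Matrix and block positions are counted from 0 below; subsystems are numbered from 1.\<close>

definition A11 :: "nat \<Rightarrow> entry mat" where
  "A11 h = mat (h + 1) (h + 1) (\<lambda>(i, j). if i = j + 1 then Free else 0)"

definition A21 :: "nat \<Rightarrow> entry mat" where
  "A21 h = mat (3 * (h div 2)) (h + 1) (\<lambda>(i, j). if (i, j) = (1, 0) then Free else 0)"

definition A22_block :: "nat \<Rightarrow> nat \<Rightarrow> entry mat" where
  "A22_block i j =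
     (if i = j then mat_of_rows_list 3
        [[Free, Free, 0],
         [Free, Free, 0],
         [0,    Free, 0]]
      else if i = j + 1 then mat_of_rows_list 3
        [[0, 0, 0],
         [0, 0, Free],
         [0, 0, 0]]
      else 0\<^sub>m 3 3)"

definition A22 :: "nat \<Rightarrow> entry mat" where
  "A22 h = mat (3 * (h div 2)) (3 * (h div 2))
     (\<lambda>(p, q). A22_block (p div 3) (q div 3) $$ (p mod 3, q mod 3))"

definition A_ext :: "nat \<Rightarrow> entry mat" where
  "A_ext h = four_block_mat (A11 h) (0\<^sub>m (h + 1) (3 * (h div 2))) (A21 h) (A22 h)"

definition B_ext :: "nat \<Rightarrow> entry mat" where
  "B_ext h = mat (h + 1 + 3 * (h div 2)) 1 (\<lambda>(i, j). if i = 0 then Free else 0)"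

definition second_order :: "nat \<Rightarrow> nat set" where
  "second_order h = {h + 2 * k | k. 1 \<le> k \<and> k \<le> h div 2}"

definition c_block :: "nat \<Rightarrow> nat \<Rightarrow> entry mat" where
  "c_block h i =
     (if i \<in> second_order h then mat_of_rows_list 2 [[Free, Free]] else mat_of_rows_list 1 [[1]])"

definition C_ext :: "nat \<Rightarrow> entry mat" where
  "C_ext h = diag_block_mat (map (c_block h) [1..<2 * h + 2])"

end

theory Submission
  imports Defs
begin

text \<open>Take every free parameter equal to 0 or 1, so that the states \<open>p\<^sub>j, q\<^sub>j, r\<^sub>j\<close> of the \<open>j\<close>-th
  right block evolve by \<open>p\<^sub>j' = q\<^sub>j\<close>, \<open>q\<^sub>j' = p\<^sub>j + r\<^sub>j\<^sub>-\<^sub>1\<close>, \<open>r\<^sub>j' = q\<^sub>j\<close>, with \<open>r\<^sub>0\<close> read as the root, and the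
  second-order subsystems output \<open>q\<^sub>j\<close>. The left branch is a pure delay line, whose outputs
  give unit columns at the times \<open>0, \<dots>, h\<close> and vanish later. On the right, each of \<open>p\<^sub>j\<close> and
  \<open>r\<^sub>j\<close> is the impulse response of \<open>(s\<^sup>2 - 1)\<^sup>-\<^sup>j\<close>, whose value at time \<open>2 l\<close> is the binomial
  coefficient of \<open>l - 1\<close> over \<open>j - 1\<close>, and \<open>q\<^sub>j\<close> is the same sequence one step earlier. So even
  and odd times decouple, and on the window \<open>h < k \<le> 2 h\<close> both parts are the \<open>h/2 \<times> h/2\<close>
  matrix of consecutive binomial coefficients, which is nonsingular by repeated differencing.\<close>

section \<open>Rank, binomial systems and diagonals of row blocks\<close>

text \<open>The hypothesis says that the leading square part \<open>S\<close> has trivial left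
  kernel. So \<open>det S\<close> is nonzero, and the columns of \<open>S\<close> are
  \<open>n\<close> independent columns of \<open>M\<close>.\<close>

lemma (in vec_space) full_row_rankI:
  assumes M: "M \<in> carrier_mat n nc" and "n \<le> nc"
    and null: "\<And>v. (\<And>k. k < n \<Longrightarrow> (\<Sum>i<n. M $$ (i, k) * v i) = 0) \<Longrightarrow> (\<And>i. i < n \<Longrightarrow> v i = 0)"
  shows "rank M = n"
proof -
  define S where "S = mat n n (\<lambda>(i, j). M $$ (i, j))"
  have S: "S \<in> carrier_mat n n" by (simp add: S_def)
  have "det (transpose_mat S) \<noteq> 0"
  proof
    assume "det (transpose_mat S) = 0"
    then obtain v where v: "v \<in> carrier_vec n" "v \<noteq> 0\<^sub>v n" "transpose_mat S *\<^sub>v v = 0\<^sub>v n"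
      using det_0_iff_vec_prod_zero_field[of "transpose_mat S" n] S by auto
    have "v $ i = 0" if "i < n" for i
    proof (rule null[OF _ that])
      fix k assume k: "k < n"
      have "(transpose_mat S *\<^sub>v v) $ k = (\<Sum>i<n. M $$ (i, k) * v $ i)"
        using k v(1) by (auto simp: S_def scalar_prod_def atLeast0LessThan intro!: sum.cong)
      then show "(\<Sum>i<n. M $$ (i, k) * v $ i) = 0" using v(3) k by simp
    qed
    then have "v = 0\<^sub>v n" using v(1) by auto
    with v(2) show False by simp
  qed
  then have rS: "rank S = n"
    using det_rank_iff[OF S] det_transpose[OF S] by simp
  \<comment> \<open>Independence concerns the set of columns; distinctness gives this set exactly
    \<open>n\<close> elements.\<close>
  have dist: "distinct (cols S)"
    using non_distinct_low_rank[OF S] rS by auto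
  have "set (cols S) \<subseteq> set (cols M)"
  proof
    fix c assume "c \<in> set (cols S)"
    then obtain j where j: "j < n" "c = col S j" using S by (auto simp: cols_def)
    then have "c = col M j" using M \<open>n \<le> nc\<close> by (auto simp: S_def)
    then show "c \<in> set (cols M)" using M j(1) \<open>n \<le> nc\<close> by (auto simp: cols_def)
  qed
  from rank_ge_card_indpt[OF M this full_rank_lin_indpt[OF S rS dist]]
  have "n \<le> rank M" using distinct_card[OF dist] S by simp
  moreover have "rank M \<le> n"
  proof -
    obtain T where T: "maximal T (\<lambda>T. T \<subseteq> set (cols M) \<and> lin_indpt T)"
      using maximal_exists_superset[of "set (cols M)" "\<lambda>T. T \<subseteq> set (cols M) \<and> lin_indpt T" "{}"]
        finite_lin_indpt2[of "{}"] by auto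
    have "T \<subseteq> carrier_vec n" "lin_indpt T"
      using T M cols_dim[of M] by (auto simp: maximal_def)
    from li_le_dim(2)[OF fin_dim this]
    show ?thesis using rank_card_indpt[OF M T] dim_is_n by simp
  qed
  ultimately show ?thesis by simp
qed

text \<open>By Pascal's rule, the difference of equations \<open>t + 1\<close> and \<open>t\<close>
  is the same kind of system for the shifted \<open>b\<close>, with one unknown fewer and the same
  \<open>a\<close>. Once the shifted entries vanish, equation 0 leaves \<open>b 0\<close>, whose
  coefficient is 1.\<close>

lemma binomial_columns_independent:
  fixes b :: "nat \<Rightarrow> 'a :: comm_ring_1"
  assumes "\<And>t. t < m \<Longrightarrow> (\<Sum>j<m. of_nat ((a + t) choose j) * b j) = 0" and "j < m"
  shows "b j = 0"
  using assms
proof (induction m arbitrary: b j)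
  case (Suc m)
  have shift: "b (Suc j) = 0" if "j < m" for j
  proof (rule Suc.IH[OF _ that])
    fix t assume t: "t < m"
    have "(\<Sum>j<m. of_nat ((a + t) choose j) * b (Suc j)) =
        (\<Sum>j<Suc m. of_nat ((a + Suc t) choose j) * b j) -
        (\<Sum>j<Suc m. of_nat ((a + t) choose j) * b j)"
      by (simp only: sum.lessThan_Suc_shift add_Suc_right binomial_Suc_Suc of_nat_add
          distrib_right sum.distrib) simp
    also have "\<dots> = 0"
      using Suc.prems(1)[of "Suc t"] Suc.prems(1)[of t] t by simp
    finally show "(\<Sum>j<m. of_nat ((a + t) choose j) * b (Suc j)) = 0" .
  qed
  moreover have "b 0 = 0"
    using Suc.prems(1)[of 0] shift by (simp add: sum.lessThan_Suc_shift del: sum.lessThan_Suc)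
  ultimately show ?case using Suc.prems(2) by (cases j) auto
qed simp

text \<open>With one-row blocks the row index is the block index, so only column offsets have to be
  tracked.\<close>

lemma index_diag_block_mat_rows:
  assumes "\<And>A. A \<in> set As \<Longrightarrow> dim_row A = 1"
    and "i < length As" and "j < sum_list (map dim_col As)"
  shows "diag_block_mat As $$ (i, j) =
    (let off = sum_list (map dim_col (take i As))
     in if off \<le> j \<and> j < off + dim_col (As ! i) then (As ! i) $$ (0, j - off) else 0)"
  using assms
proof (induction As arbitrary: i j)
  case (Cons A As)
  have rows: "dim_row (diag_block_mat As) = length As"
    using Cons.prems(1) by (induction As) (auto simp: Let_def)
  show ?case
  proof (cases i)
    case 0
    then show ?thesis using Cons.prems rows
      by (auto simp: Let_def dim_diag_block_mat)
  next
    case (Suc i')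
    show ?thesis
    proof (cases "j < dim_col A")
      case True
      then show ?thesis using Cons.prems rows Suc
        by (auto simp: Let_def dim_diag_block_mat)
    next
      case False
      have "diag_block_mat (A # As) $$ (i, j) = diag_block_mat As $$ (i', j - dim_col A)"
        using Cons.prems rows Suc False by (auto simp: Let_def dim_diag_block_mat)
      also have "\<dots> = (let off = sum_list (map dim_col (take i' As))
         in if off \<le> j - dim_col A \<and> j - dim_col A < off + dim_col (As ! i')
            then (As ! i') $$ (0, j - dim_col A - off) else 0)"
        using Cons.prems Suc False by (intro Cons.IH) auto
      finally show ?thesis using Suc False by (auto simp: Let_def)
    qed
  qed
qed simp

section \<open>The 0/1 realization and its state trajectories\<close>

text \<open>All three realized matrices have this form; multiplying by one on the left just adds up
  selected rows.\<close>

definition row_support_mat :: "nat \<Rightarrow> nat \<Rightarrow> (nat \<Rightarrow> nat set) \<Rightarrow> real mat" where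
  "row_support_mat r c S = mat r c (\<lambda>(i, j). of_bool (j \<in> S i))"

lemma row_support_mat_mult_index:
  assumes "i < r" "k < dim_col M" "dim_row M = c" "S i \<subseteq> {..<c}"
  shows "(row_support_mat r c S * M) $$ (i, k) = (\<Sum>j\<in>S i. M $$ (j, k))"
proof -
  have "(row_support_mat r c S * M) $$ (i, k) = (\<Sum>j<c. of_bool (j \<in> S i) * M $$ (j, k))"
    using assms by (auto simp: row_support_mat_def scalar_prod_def atLeast0LessThan)
  also have "\<dots> = (\<Sum>j\<in>S i. of_bool (j \<in> S i) * M $$ (j, k))"
    using assms(4) by (intro sum.mono_neutral_right) auto
  finally show ?thesis by simp
qed

text \<open>The states feeding state \<open>i\<close>. State 0 is the root, and right block
  \<open>d\<close>, counted from 0, holds p, q, r at \<open>h + 1 + 3 * d\<close> and the next two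
  indices. In the q row, \<open>i - 2\<close> is the r of the preceding block, replaced by the root
  in the first block.\<close>

definition dynamics_support :: "nat \<Rightarrow> nat \<Rightarrow> nat set" where
  "dynamics_support h i =
     (if i = 0 then {} else if i \<le> h then {i - 1}
      else if (i - h - 1) mod 3 = 0 then {i + 1}
      else if (i - h - 1) mod 3 = 1 then {i - 1, if i = h + 2 then 0 else i - 2}
      else {i - 1})"

text \<open>The state read by output \<open>i\<close>. Truncated subtraction gives \<open>i\<close>
  itself up to \<open>h\<close>; beyond that, the formula lands on the q or the r of a right block,
  never on a p.\<close>

definition output_state :: "nat \<Rightarrow> nat \<Rightarrow> nat" where
  "output_state h i = i + (i + 1 - h) div 2"

text \<open>With blocks counted from 0: the coefficient of \<open>s\<^sup>-\<^sup>k\<close> in \<open>(s\<^sup>2 - 1)\<^sup>-\<^sup>(\<^sup>j\<^sup>+\<^sup>1\<^sup>)\<close>.\<close>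

definition cascade_coeff :: "nat \<Rightarrow> nat \<Rightarrow> real" where
  "cascade_coeff j k = (if even k \<and> k > 0 then of_nat ((k div 2 - 1) choose j) else 0)"

definition trajectory :: "nat \<Rightarrow> nat \<Rightarrow> nat \<Rightarrow> real" where
  "trajectory h k i =
     (if i \<le> h then of_bool (k = i)
      else cascade_coeff ((i - h - 1) div 3) (if (i - h - 1) mod 3 = 1 then k + 1 else k))"

text \<open>Multiplying the inverse of s^2 - 1 by s^2 - 1 gives 1, read off coefficientwise; the
  \<open>of_bool\<close> term is the impulse.\<close>

lemma cascade_coeff_0_rec: "cascade_coeff 0 (k + 2) = cascade_coeff 0 k + of_bool (k = 0)"
  by (auto simp: cascade_coeff_def)

lemma cascade_coeff_Suc_rec:
  "cascade_coeff (Suc j) (k + 2) = cascade_coeff (Suc j) k + cascade_coeff j k"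
proof (cases "even k \<and> k > 0")
  case True
  then obtain l where "k = 2 * Suc l"
    by (metis dvd_def gr0_conv_Suc mult_0_right not_gr0)
  then show ?thesis by (simp add: cascade_coeff_def)
qed (auto simp: cascade_coeff_def)

text \<open>The left branch shifts. The p and r rows copy q, which runs one step ahead of them. The
  q row is the cascade recurrence, with the root's impulse as input to the first block.\<close>

lemma trajectory_Suc:
  "(\<Sum>j\<in>dynamics_support h i. trajectory h k j) = trajectory h (Suc k) i"
proof (cases "i \<le> h")
  case True
  then show ?thesis by (auto simp: dynamics_support_def trajectory_def)
next
  case False
  define t where "t = i - h - 1"
  define d where "d = t div 3"
  have it: "i = h + 1 + t" using False by (simp add: t_def)
  have "t mod 3 < 3" by simp
  then consider "t = 3 * d" | "t = 3 * d + 1" | "t = 3 * d + 2"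
    unfolding d_def by (metis One_nat_def Suc_1 add.right_neutral add_Suc_right less_Suc_eq
        mult_div_mod_eq not_less_eq numeral_3_eq_3 less_Suc0)
  then show ?thesis
  proof cases
    case 1
    moreover have "Suc (3 * d) div 3 = d" by simp
    ultimately show ?thesis using it by (simp add: dynamics_support_def trajectory_def)
  next
    case 2
    show ?thesis
    proof (cases d)
      case 0
      then show ?thesis using it 2 cascade_coeff_0_rec[of k]
        by (simp add: dynamics_support_def trajectory_def)
    next
      case (Suc d')
      then have "t - 2 = 3 * d' + 2" using 2 by simp
      moreover have "(3 * d' + 2) mod 3 = 2" "(3 * d' + 2) div 3 = d'" by presburger+
      ultimately have "(t - 2) mod 3 = 2" "(t - 2) div 3 = d'" by simp_all
      then show ?thesis using it 2 Suc cascade_coeff_Suc_rec[of d' k]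
        by (simp add: dynamics_support_def trajectory_def)
    qed
  next
    case 3
    moreover have "Suc (3 * d) div 3 = d" "Suc (Suc (3 * d)) div 3 = d"
        "Suc (Suc (3 * d)) mod 3 = 2" by presburger+
    ultimately show ?thesis using it by (simp add: dynamics_support_def trajectory_def)
  qed
qed

lemma dynamics_support_bound:
  assumes "i < h + 1 + 3 * m" shows "dynamics_support h i \<subseteq> {..<h + 1 + 3 * m}"
proof -
  \<comment> \<open>Only p rows refer to a later state, namely the q of the same block.\<close>
  have "i + 1 < h + 1 + 3 * m" if "(i - h - 1) mod 3 = 0" "h < i"
    using assms that by presburger
  then show ?thesis using assms by (auto simp: dynamics_support_def)
qed

lemma output_state_bound:
  assumes "i < 2 * (2 * m) + 1" shows "output_state (2 * m) i < 2 * m + 1 + 3 * m"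
proof -
  have "(i + 1 - 2 * m) div 2 \<le> (2 * m + 1) div 2"
    using assms by (intro div_le_mono) linarith
  then show ?thesis using assms by (simp add: output_state_def)
qed

text \<open>The power unfolds with the new factor on the right, whereas the state recursion applies
  \<open>A\<close> last, on the left.\<close>

lemma pow_mat_Suc_left:
  fixes A :: "'a :: semiring_1 mat"
  assumes A: "A \<in> carrier_mat n n"
  shows "A ^\<^sub>m Suc k = A * A ^\<^sub>m k"
proof (induction k)
  case (Suc k)
  then show ?case
    using assoc_mult_mat[OF A pow_carrier_mat[OF A, of k] A] by simp
qed (use A in simp)

lemma power_mult_impulse:
  assumes N: "N = h + 1 + 3 * m" and i: "i < N"
  shows "(row_support_mat N N (dynamics_support h) ^\<^sub>m k * row_support_mat N 1 (\<lambda>i. {j. i = 0}))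
           $$ (i, 0) = trajectory h k i"
    (is "(?A ^\<^sub>m k * ?B) $$ _ = _")
  using i
proof (induction k arbitrary: i)
  case 0
  have "?B \<in> carrier_mat N 1" by (simp add: row_support_mat_def)
  then have "?A ^\<^sub>m 0 * ?B = ?B" by (simp add: row_support_mat_def)
  \<comment> \<open>At time 0 all right states vanish: p and r by the condition \<open>k > 0\<close>
    in \<open>cascade_coeff\<close>, q because its argument 1 is odd.\<close>
  then show ?case using 0
    by (auto simp: row_support_mat_def trajectory_def cascade_coeff_def)
next
  case (Suc k)
  have A: "?A \<in> carrier_mat N N" and B: "?B \<in> carrier_mat N 1"
    by (simp_all add: row_support_mat_def)
  have "?A ^\<^sub>m Suc k = ?A * ?A ^\<^sub>m k" 
    by (rule pow_mat_Suc_left[OF A])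
  then have "?A ^\<^sub>m Suc k * ?B = ?A * (?A ^\<^sub>m k * ?B)"
    using assoc_mult_mat[OF A pow_carrier_mat[OF A] B] by metis
  moreover have "(?A * (?A ^\<^sub>m k * ?B)) $$ (i, 0) =
      (\<Sum>j\<in>dynamics_support h i. (?A ^\<^sub>m k * ?B) $$ (j, 0))"
    using Suc.prems A B N dynamics_support_bound by (intro row_support_mat_mult_index) auto
  moreover have "\<dots> = (\<Sum>j\<in>dynamics_support h i. trajectory h k j)"
    using Suc.IH dynamics_support_bound[of i h m] Suc.prems N by (intro sum.cong refl) blast
  ultimately show ?case using trajectory_Suc[of h k i] by simp
qed

section \<open>Independence of the output sequences\<close>

lemma sum_lessThan_double: "(\<Sum>i<2 * m. f i) = (\<Sum>j<m. f (2 * j) + f (2 * j + 1 :: nat))"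
  for f :: "nat \<Rightarrow> 'a :: comm_monoid_add"
  by (induction m) (simp_all add: add.assoc)

lemma output_trajectories_independent:
  assumes null: "\<And>k. k < 2 * (2 * m) + 1 \<Longrightarrow>
      (\<Sum>i<2 * (2 * m) + 1. trajectory (2 * m) k (output_state (2 * m) i) * v i) = 0"
    and i: "i < 2 * (2 * m) + 1"
  shows "v i = 0"
proof -
  define h where "h = 2 * m"
  define y where "y k i = trajectory h k (output_state h i)" for k i
  have left: "y k i = of_bool (k = i)" if "i \<le> h" for i k
    using that by (cases "i = h") (auto simp: y_def output_state_def trajectory_def)
  have q: "y k (h + 1 + 2 * j) = cascade_coeff j (k + 1)" for j k
  proof -
    have "output_state h (h + 1 + 2 * j) = h + 1 + (3 * j + 1)"
      by (simp add: output_state_def)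
    moreover have "(3 * j + 1) div 3 = j" "(3 * j + 1) mod 3 = 1" by presburger+
    ultimately show ?thesis unfolding y_def by (simp add: trajectory_def)
  qed
  have r: "y k (h + 1 + (2 * j + 1)) = cascade_coeff j k" for j k
  proof -
    have "output_state h (h + 1 + (2 * j + 1)) = h + 1 + (3 * j + 2)"
      by (simp add: output_state_def)
    moreover have "(3 * j + 2) div 3 = j" "(3 * j + 2) mod 3 = 2" by presburger+
    ultimately show ?thesis unfolding y_def by (simp add: trajectory_def)
  qed
  have split: "(\<Sum>i<2 * (2 * m) + 1. y k i * v i) =
      (\<Sum>i<h + 1. y k i * v i) +
      (\<Sum>j<m. cascade_coeff j (k + 1) * v (h + 1 + 2 * j) +
              cascade_coeff j k * v (h + 1 + (2 * j + 1)))" for k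
  proof -
    have "(\<Sum>i<(h + 1) + 2 * m. y k i * v i) =
        (\<Sum>i<h + 1. y k i * v i) + (\<Sum>i<2 * m. y k (h + 1 + i) * v (h + 1 + i))"
      by (induction m) (simp_all add: algebra_simps)
    then show ?thesis
      by (simp only: sum_lessThan_double q r) (simp add: h_def algebra_simps)
  qed
  have zero: "(\<Sum>i<h + 1. y k i * v i) +
      (\<Sum>j<m. cascade_coeff j (k + 1) * v (h + 1 + 2 * j) +
              cascade_coeff j k * v (h + 1 + (2 * j + 1))) = 0" if "k \<le> 2 * h" for k
    using null[of k] that split[of k] by (simp add: y_def h_def)
  have left0: "(\<Sum>i<h + 1. y k i * v i) = 0" if "k > h" for k
    using that by (intro sum.neutral) (auto simp: left)
  \<comment> \<open>At odd times the r terms vanish. The times \<open>2 * (m + t) + 1\<close> with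
    \<open>t < m\<close> are the odd ones between \<open>h\<close> and \<open>2 * h\<close>, and
    there the q coefficients are binomials with top \<open>m + t\<close>.\<close>
  have vq: "v (h + 1 + 2 * j) = 0" if "j < m" for j
  proof (rule binomial_columns_independent[OF _ that, where a = m])
    fix t assume "t < m"
    then show "(\<Sum>j<m. of_nat ((m + t) choose j) * v (h + 1 + 2 * j)) = 0"
      using zero[of "2 * (m + t) + 1"] left0[of "2 * (m + t) + 1"]
      by (simp add: cascade_coeff_def h_def)
  qed
  \<comment> \<open>The even times \<open>2 * (m + t) + 2\<close> isolate the r terms with the same
    binomials; the last of them is exactly \<open>2 * h\<close>.\<close>
  have vr: "v (h + 1 + (2 * j + 1)) = 0" if "j < m" for j
  proof (rule binomial_columns_independent[OF _ that, where a = m])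
    fix t assume "t < m"
    then show "(\<Sum>j<m. of_nat ((m + t) choose j) * v (h + 1 + (2 * j + 1))) = 0"
      using zero[of "2 * (m + t) + 2"] left0[of "2 * (m + t) + 2"]
      by (simp add: cascade_coeff_def h_def)
  qed
  show ?thesis
  proof (cases "i \<le> h")
    case True
    \<comment> \<open>With the right coefficients gone, time \<open>i\<close> isolates left output
      \<open>i\<close>.\<close>
    have "(\<Sum>i'<h + 1. y i i' * v i') = (\<Sum>i'<h + 1. if i = i' then v i' else 0)"
      by (intro sum.cong) (auto simp: left)
    also have "\<dots> = v i" using True by (simp del: sum.lessThan_Suc)
    finally have "(\<Sum>i'<h + 1. y i i' * v i') = v i" .
    moreover have "(\<Sum>j<m. cascade_coeff j (i + 1) * v (h + 1 + 2 * j) +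
        cascade_coeff j i * v (h + 1 + (2 * j + 1))) = 0"
      by (intro sum.neutral ballI) (simp only: vq vr lessThan_iff mult_zero_right add_0_right)
    ultimately show ?thesis using zero[of i] True by simp
  next
    case False
    then obtain t where t: "i = h + 1 + t"
      by (metis Suc_eq_plus1 add.assoc add.commute not_le less_iff_Suc_add)
    then have "t div 2 < m" using i by (simp add: h_def)
    then show ?thesis using vq[of "t div 2"] vr[of "t div 2"] t
      by (cases "even t") (auto elim: evenE oddE)
  qed
qed

section \<open>Compatibility with the structured pattern\<close>

lemma A22_block_index:
  assumes "r < 3" "s < 3"
  shows "A22_block a b $$ (r, s) =
    (if a = b \<and> (r, s) \<in> {(0, 0), (0, 1), (1, 0), (1, 1), (2, 1)} \<or>
        a = b + 1 \<and> (r, s) = (1, 2) then Free else Fixed 0)"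
proof -
  have r: "r = 0 \<or> r = 1 \<or> r = 2" and s: "s = 0 \<or> s = 1 \<or> s = 2"
    using assms by linarith+
  consider "a = b" | "a = b + 1" | "a \<noteq> b" "a \<noteq> b + 1" by blast
  then show ?thesis
  proof cases
    case 1
    from r s show ?thesis unfolding 1
      by (elim disjE) (simp_all add: A22_block_def mat_of_rows_list_def zero_entry_def)
  next
    case 2
    from r s show ?thesis unfolding 2
      by (elim disjE) (simp_all add: A22_block_def mat_of_rows_list_def zero_entry_def)
  next
    case 3
    then show ?thesis using assms by (simp add: A22_block_def zero_entry_def)
  qed
qed

lemma realization_A_ext:
  assumes h: "h = 2 * m" and N: "N = h + 1 + 3 * m"
  shows "realization (A_ext h) (row_support_mat N N (dynamics_support h))"
proof -
  \<comment> \<open>Free positions impose nothing, so the second alternative absorbs free entries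
    set to 0, such as the self-loops. What matters is that every 1 sits on a free position.\<close>
  have entry: "A_ext h $$ (i, j) = (if j \<in> dynamics_support h i then Free else Fixed 0) \<or>
      A_ext h $$ (i, j) = Free"
    if "i < N" "j < N" for i j
  proof (cases "i \<le> h \<or> j \<le> h")
    case True
    then show ?thesis using that N
      by (auto simp: A_ext_def A11_def A21_def A22_def h zero_entry_def dynamics_support_def)
  next
    case False
    define a r b s where "a = (i - h - 1) div 3" and "r = (i - h - 1) mod 3"
      and "b = (j - h - 1) div 3" and "s = (j - h - 1) mod 3"
    have r3: "r < 3" and s3: "s < 3" by (simp_all add: r_def s_def)
    have i: "i = h + 1 + (3 * a + r)" and j: "j = h + 1 + (3 * b + s)"
      using False by (simp_all add: a_def r_def b_def s_def)
    have "i - h - 1 < 3 * m" "j - h - 1 < 3 * m" using that False N by linarith+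
    then have "A_ext h $$ (i, j) = A22_block a b $$ (r, s)"
      using False that N by (simp add: A_ext_def A11_def A22_def h a_def r_def b_def s_def)
    moreover have "a = b \<and> (r, s) \<in> {(0, 0), (0, 1), (1, 0), (1, 1), (2, 1)} \<or>
        a = b + 1 \<and> (r, s) = (1, 2)" if "j \<in> dynamics_support h i"
    proof -
      have rm: "(i - h - 1) mod 3 = r" by (simp add: r_def)
      consider "r = 0" | "r = 1" | "r = 2" using r3 by linarith
      then show ?thesis
      proof cases
        case 1
        then have "3 * b + s = 3 * a + 1"
          using that i j rm by (simp add: dynamics_support_def)
        then have "a = b \<and> s = 1" using s3 by presburger
        then show ?thesis using 1 by simp
      next
        case 2
        \<comment> \<open>The root cannot occur here since \<open>j > h\<close>; what remains is the
          p of the same block or the r of the preceding one.\<close>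
        then have "3 * b + s = 3 * a \<or> 3 * b + s + 1 = 3 * a"
          using that i j rm by (auto simp: dynamics_support_def split: if_splits)
        then have "a = b \<and> s = 0 \<or> a = b + 1 \<and> s = 2" using s3 by presburger
        then show ?thesis using 2 by auto
      next
        case 3
        then have "3 * b + s = 3 * a + 1"
          using that i j rm by (simp add: dynamics_support_def)
        then have "a = b \<and> s = 1" using s3 by presburger
        then show ?thesis using 3 by simp
      qed
    qed
    ultimately show ?thesis using A22_block_index[OF r3 s3, of a b] by auto
  qed
  have "dim_row (A_ext h) = N" "dim_col (A_ext h) = N"
    by (simp_all add: A_ext_def A11_def A22_def h N)
  then show ?thesis unfolding realization_def
    using entry by (force simp: row_support_mat_def split: if_splits)
qed

lemma realization_B_ext:
  assumes "h = 2 * m" and "N = h + 1 + 3 * m"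
  shows "realization (B_ext h) (row_support_mat N 1 (\<lambda>i. {j. i = 0}))"
  using assms by (auto simp: realization_def B_ext_def row_support_mat_def zero_entry_def)

lemma
  assumes h: "h = 2 * m" and N: "N = h + 1 + 3 * m"
  shows dim_row_C_ext: "dim_row (C_ext h) = 2 * h + 1"
    and dim_col_C_ext: "dim_col (C_ext h) = N"
    and realization_C_ext:
      "realization (C_ext h) (row_support_mat (2 * h + 1) N (\<lambda>i. {output_state h i}))"
proof -
  let ?As = "map (c_block h) [1..<2 * h + 2]"
  have so: "i \<in> second_order h \<longleftrightarrow> h < i \<and> even i" if "i < 2 * h + 2" for i
  proof
    assume "i \<in> second_order h"
    then show "h < i \<and> even i" by (auto simp: second_order_def h)
  next
    assume i: "h < i \<and> even i"
    then obtain l where l: "i = 2 * l" by (elim conjE evenE)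
    then have "i = h + 2 * (l - m)" "1 \<le> l - m" "l - m \<le> h div 2"
      using i that h by auto
    then show "i \<in> second_order h" unfolding second_order_def by blast
  qed
  have bcol: "dim_col (c_block h i) = (if h < i \<and> even i then 2 else 1)" if "i < 2 * h + 2" for i
    using so[OF that] by (simp add: c_block_def mat_of_rows_list_def)
  have rows: "dim_row A = 1" if "A \<in> set ?As" for A
    using that by (auto simp: c_block_def mat_of_rows_list_def)
  \<comment> \<open>Among subsystems 1 to \<open>i\<close>, exactly \<open>(i - h) div 2\<close> are
    second-order, each adding one extra column.\<close>
  have off: "sum_list (map dim_col (take i ?As)) = i + (i - h) div 2" if "i \<le> 2 * h + 1" for i
    using that
  proof (induction i)
    case (Suc i)
    then have "take (Suc i) ?As = take i ?As @ [c_block h (Suc i)]"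
      by (simp add: take_Suc_conv_app_nth del: upt_Suc)
    moreover have "(Suc i - h) div 2 = (i - h) div 2 + of_bool (h < Suc i \<and> even (Suc i))"
    proof (cases "h \<le> i")
      case True
      then obtain t where "i = h + t" using le_Suc_ex by blast
      then show ?thesis using h by (cases "even t") (auto elim!: evenE oddE)
    qed simp
    ultimately show ?case using Suc bcol[of "Suc i"] by (simp del: upt_Suc)
  qed simp
  show row: "dim_row (C_ext h) = 2 * h + 1"
  proof -
    have "map dim_row ?As = map (\<lambda>_. 1) ?As" using rows by (intro map_cong refl) blast
    then show ?thesis
      unfolding C_ext_def dim_diag_block_mat
      by (simp only: sum_list_triv of_nat_id length_map length_upt)
  qed
  show col: "dim_col (C_ext h) = N"
    using off[of "2 * h + 1"] unfolding C_ext_def dim_diag_block_mat by (simp add: h N)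
  have "C_ext h $$ (i, j) = (if j = output_state h i then Fixed 1 else Fixed 0) \<or>
      C_ext h $$ (i, j) = Free" if "i < 2 * h + 1" "j < N" for i j
  proof -
    have "C_ext h $$ (i, j) =
      (let off = i + (i - h) div 2
       in if off \<le> j \<and> j < off + dim_col (c_block h (Suc i))
          then c_block h (Suc i) $$ (0, j - off) else 0)"
    proof -
      have "?As ! i = c_block h (Suc i)" "i < length ?As"
        using that by (simp_all add: nth_append del: upt_Suc)
      moreover have "j < sum_list (map dim_col ?As)"
        using col that unfolding C_ext_def dim_diag_block_mat by simp
      ultimately show ?thesis
        using index_diag_block_mat_rows[of ?As i j] off[of i] rows that
        unfolding C_ext_def by (metis less_imp_le)
    qed
    \<comment> \<open>Row \<open>i\<close> belongs to subsystem \<open>Suc i\<close>; the last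
      summand selects the second of the two columns when that subsystem is second-order.\<close>
    moreover have "output_state h i = i + (i - h) div 2 + of_bool (h < Suc i \<and> even (Suc i))"
    proof (cases "h \<le> i")
      case True
      then obtain t where "i = h + t" using le_Suc_ex by blast
      then show ?thesis using h unfolding output_state_def
        by (cases "even t") (auto elim!: evenE oddE)
    qed (simp add: output_state_def)
    moreover have "if h < Suc i \<and> even (Suc i)
        then dim_col (c_block h (Suc i)) = 2 \<and>
          (\<forall>k<2. c_block h (Suc i) $$ (0, k) = Free)
        else dim_col (c_block h (Suc i)) = 1 \<and> c_block h (Suc i) $$ (0, 0) = Fixed 1"
      using so[of "Suc i"] that
      by (auto simp: c_block_def mat_of_rows_list_def one_entry_def less_2_cases_iff)
    moreover define a where "a = i + (i - h) div 2"
    ultimately have entry: "C_ext h $$ (i, j) =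
          (if a \<le> j \<and> j < a + dim_col (c_block h (Suc i))
           then c_block h (Suc i) $$ (0, j - a) else Fixed 0)"
      and out: "output_state h i = a + of_bool (h < Suc i \<and> even (Suc i))"
      and block: "if h < Suc i \<and> even (Suc i)
        then dim_col (c_block h (Suc i)) = 2 \<and>
          (\<forall>k<2. c_block h (Suc i) $$ (0, k) = Free)
        else dim_col (c_block h (Suc i)) = 1 \<and> c_block h (Suc i) $$ (0, 0) = Fixed 1"
      by (simp_all only: Let_def zero_entry_def)
    show ?thesis
    proof (cases "h < Suc i \<and> even (Suc i)")
      case True
      then have "dim_col (c_block h (Suc i)) = 2" "\<forall>k<2. c_block h (Suc i) $$ (0, k) = Free"
        using block unfolding if_P[OF True] by blast+
      moreover have "output_state h i = a + 1"
        using True out by (simp only: simp_thms of_bool_eq)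
      ultimately show ?thesis using entry by auto
    next
      case False
      then have "dim_col (c_block h (Suc i)) = 1" "c_block h (Suc i) $$ (0, 0) = Fixed 1"
          "output_state h i = a"
        using block out by (simp_all only: if_False of_bool_eq add_0_right)
      then show ?thesis using entry by (cases "j = a") auto
    qed
  qed
  then show "realization (C_ext h) (row_support_mat (2 * h + 1) N (\<lambda>i. {output_state h i}))"
    unfolding realization_def row col
    by (force simp: row_support_mat_def split: if_splits)
qed

section \<open>Rank of the realized output controllability matrix\<close>

theorem proposition4:
  fixes h :: nat
  assumes "even h" and "h \<ge> 2"
  shows "structurally_output_controllable (A_ext h) (B_ext h) (C_ext h)"
proof -
  obtain m where h: "h = 2 * m" using assms(1) by (elim evenE)
  define N where "N = h + 1 + 3 * m"
  define A where "A = row_support_mat N N (dynamics_support h)"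
  define B where "B = row_support_mat N 1 (\<lambda>i. {j. i = 0})"
  define C where "C = row_support_mat (2 * h + 1) N (\<lambda>i. {output_state h i})"
  note real = realization_A_ext[OF h N_def] realization_B_ext[OF h N_def]
    realization_C_ext[OF h N_def]
  have dims: "dim_row A = N" "dim_col A = N" "dim_row B = N" "dim_col B = 1"
      "dim_row C = 2 * h + 1" "dim_col C = N"
    by (simp_all add: A_def B_def C_def row_support_mat_def)
  have Sdims: "dim_row (A_ext h) = N" "dim_col (A_ext h) = N" "dim_row (B_ext h) = N"
      "dim_col (C_ext h) = N"
    using dim_col_C_ext[OF h N_def]
    by (simp_all add: A_ext_def A11_def A22_def B_ext_def h N_def)
  let ?K = "controllability_mat A B"
  have K: "?K \<in> carrier_mat N N" by (simp add: controllability_mat_def dims)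
  have Kentry: "?K $$ (i, k) = trajectory h k i" if "i < N" "k < N" for i k
  proof -
    have "(A ^\<^sub>m k * B) $$ (i, 0) = trajectory h k i"
      unfolding A_def B_def by (rule power_mult_impulse[OF N_def that(1)])
    then show ?thesis using that
      by (simp add: controllability_mat_def dims del: index_mult_mat)
  qed
  have entry: "(C * ?K) $$ (i, k) = trajectory h k (output_state h i)"
    if "i < 2 * h + 1" "k < N" for i k
  proof -
    have o: "output_state h i < N" using output_state_bound[of i m] that h N_def by simp
    then have "(C * ?K) $$ (i, k) = (\<Sum>j\<in>{output_state h i}. ?K $$ (j, k))"
      unfolding C_def using that K by (intro row_support_mat_mult_index) auto
    then show ?thesis using Kentry[OF o that(2)] by simp
  qed
  have "vec_space.rank (2 * h + 1) (C * ?K) = 2 * h + 1"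
  proof (rule vec_space.full_row_rankI)
    show "C * ?K \<in> carrier_mat (2 * h + 1) N" using K dims by auto
    \<comment> \<open>Since \<open>N = 5 * m + 1\<close>, the times 0 to
      \<open>2 * h = 4 * m\<close> are all among the columns of the controllability matrix.\<close>
    show "2 * h + 1 \<le> N" by (simp add: N_def h)
    fix v :: "nat \<Rightarrow> real" and i
    assume "\<And>k. k < 2 * h + 1 \<Longrightarrow> (\<Sum>i<2 * h + 1. (C * ?K) $$ (i, k) * v i) = 0"
      and i: "i < 2 * h + 1"
    then have "(\<Sum>i<2 * h + 1. trajectory h k (output_state h i) * v i) = 0"
      if "k < 2 * h + 1" for k
      using entry \<open>2 * h + 1 \<le> N\<close> that by fastforce
    then show "v i = 0"
      using output_trajectories_independent[of m v i] i h by blast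
  qed
  then have "output_controllable A B C"
    by (simp add: output_controllable_def dims)
  then show ?thesis
    unfolding structurally_output_controllable_def
    using real Sdims A_def B_def C_def by metis
qed

end
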